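(* Let $F=f+h$ on $\mathbb{R}^{n}$, where $f:\mathbb{R}^n\to\mathbb{R}$ is $\sigma$-strongly convex ($\sigma\ge 0$) and $L$-smooth ($L\ge 0$), $h:\mathbb{R}^n\to\mathbb{R}$ is convex with a given $(1/\mu)$-smooth approximation $\widetilde h(\cdot,\mu)$ with parameters $(\alpha,\beta)$, and $F$ has a minimizer $x^*$. Let $\widetilde F(x,\mu)=f(x)+\widetilde h(x,\mu)$. Let $\mu:[t_0,+\infty)\to(0,+\infty)$ be a non-increasing function with $\lim_{t\to+\infty}\mu(t)=0$. Let $x^{(0)}\in\mathbb{R}^n$ and, for $k\ge 0$, $$s_k=(L+\alpha/\mu(t_k))^{-1},\qquad t_{k+1}=t_k+(L+\alpha/\mu(t_k))^{-1},\qquad x^{(k+1)}=x^{(k)}-s_k\nabla_x\widetilde F(x^{(k)},\mu(t_k)).$$ Then $\lim_{k\to+\infty}\bigl(f(x^{(k)})+h(x^{(k)})\bigr)=f(x^* )+h(x^* )$, and if $\sigma>0$ then $\lim_{k\to+\infty}x^{(k)}=x^*$.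
   Context: A function is $L$-smooth if it is differentiable with $L$-Lipschitz gradient (Euclidean norm). A function $f$ is $\sigma$-strongly convex with $\sigma\ge 0$ if $f-\frac{\sigma}{2}\|\cdot\|_2^2$ is convex ($\sigma=0$ means merely convex). Let $h:\mathbb{R}^n\to\mathbb{R}$ be convex. A family of convex differentiable functions $\widetilde h(\cdot,\mu):\mathbb{R}^n\to\mathbb{R}$ ($\mu>0$) is a $(1/\mu)$-smooth approximation of $h$ with parameters $(\alpha,\beta)$ ($\alpha,\beta>0$) if for every $\mu>0$: (1) $\widetilde h(x,\mu)\le h(x)\le\widetilde h(x,\mu)+\beta\mu$ for all $x\in\mathbb{R}^n$; (2) $\widetilde h(\cdot,\mu)$ is $(\alpha/\mu)$-smooth. *)

theory Defs
  imports "HOL-Analysis.Analysis"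
begin

definition gradient :: "('a::real_inner \<Rightarrow> real) \<Rightarrow> 'a \<Rightarrow> 'a" where
  "gradient f x = (THE D. GDERIV f x :> D)"

lemma gradient_eqI:
  assumes "GDERIV f x :> D"
  shows "gradient f x = D"
  unfolding gradient_def
proof (rule the_equality[where P = "\<lambda>D. GDERIV f x :> D"])
  show "GDERIV f x :> D" by fact
next
  fix D' assume "GDERIV f x :> D'"
  then have "(\<lambda>h. h \<bullet> D') = (\<lambda>h. h \<bullet> D)"
    using assms unfolding gderiv_def by (rule has_derivative_unique)
  then have "h \<bullet> D' = h \<bullet> D" for h
    by (rule fun_cong)
  then show "D' = D"
    using vector_eq_ldot[of D' D] by simp
qed

lemma GDERIV_gradient:
  fixes f :: "'a::euclidean_space \<Rightarrow> real"
  assumes "f differentiable (at x)"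
  shows "GDERIV f x :> gradient f x"
proof -
  obtain f' where f': "(f has_derivative f') (at x)"
    using assms by (auto simp: differentiable_def)
  then interpret linear f' by (rule has_derivative_linear)
  have "f' h = h \<bullet> (\<Sum>b\<in>Basis. f' b *\<^sub>R b)" for h
  proof -
    have "f' h = f' (\<Sum>b\<in>Basis. (h \<bullet> b) *\<^sub>R b)"
      by (simp add: euclidean_representation)
    also have "\<dots> = (\<Sum>b\<in>Basis. (h \<bullet> b) * f' b)"
      by (simp add: sum scale)
    also have "\<dots> = h \<bullet> (\<Sum>b\<in>Basis. f' b *\<^sub>R b)"
      by (simp add: inner_sum_right mult.commute)
    finally show ?thesis .
  qed
  then have "f' = (\<lambda>h. h \<bullet> (\<Sum>b\<in>Basis. f' b *\<^sub>R b))"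
    by (rule ext)
  with f' have "GDERIV f x :> (\<Sum>b\<in>Basis. f' b *\<^sub>R b)"
    by (simp add: gderiv_def)
  then show ?thesis
    by (simp add: gradient_eqI)
qed

definition smooth_fun :: "real \<Rightarrow> ('a::real_inner \<Rightarrow> real) \<Rightarrow> bool" where
  "smooth_fun L f \<longleftrightarrow>
     (\<forall>x. f differentiable (at x)) \<and> L-lipschitz_on UNIV (gradient f)"

definition strongly_convex :: "real \<Rightarrow> ('a::real_inner \<Rightarrow> real) \<Rightarrow> bool" where
  "strongly_convex \<sigma> f \<longleftrightarrow>
     0 \<le> \<sigma> \<and> convex_on UNIV (\<lambda>x. f x - \<sigma> / 2 * (norm x)\<^sup>2)"

text \<open>Only the values of the family at positive smoothing parameters are constrained.\<close>

definition smooth_approximation ::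
  "real \<Rightarrow> real \<Rightarrow> ('a::real_inner \<Rightarrow> real) \<Rightarrow> ('a \<Rightarrow> real \<Rightarrow> real) \<Rightarrow> bool" where
  "smooth_approximation \<alpha> \<beta> h ht \<longleftrightarrow>
     0 < \<alpha> \<and> 0 < \<beta> \<and>
     (\<forall>\<mu>>0. convex_on UNIV (\<lambda>x. ht x \<mu>) \<and>
            (\<forall>x. ht x \<mu> \<le> h x \<and> h x \<le> ht x \<mu> + \<beta> * \<mu>) \<and>
            smooth_fun (\<alpha> / \<mu>) (\<lambda>x. ht x \<mu>))"

end

theory Submission
  imports Defs
begin

text \<open>
  A step of length \<open>s\<^sub>k = t\<^sub>k\<^sub>+\<^sub>1 - t\<^sub>k\<close> that is one over the smoothness constant of the smoothed objective
  satisfies the three-point inequality of gradient descent for that objective. Replacing the smoothed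
  objective by \<open>F = f + h\<close> costs at most \<open>\<beta> \<mu>(t\<^sub>k)\<close>, so that for \<^emph>\<open>every\<close> point \<open>y\<close>
  \<open>|x\<^sub>k\<^sub>+\<^sub>1 - y|\<^sup>2 \<le> |x\<^sub>k - y|\<^sup>2 - 2 s\<^sub>k (F(x\<^sub>k\<^sub>+\<^sub>1) - F(y) - e\<^sub>k)\<close>, where \<open>e\<^sub>k = \<beta> \<mu>(t\<^sub>k)\<close>.
  The times \<open>t\<^sub>k\<close> diverge, since otherwise \<open>\<mu>(t\<^sub>k)\<close>, and with it the step length, would stay bounded away
  from zero. Hence \<open>e\<^sub>k\<close> tends to zero and the step lengths have infinite sum. The rest of the argument
  uses only these two facts and the inequality.

  Taking \<open>y\<close> to be a minimizer shows that \<open>F(x\<^sub>k)\<close> comes close to the minimum infinitely often. The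
  difficulty is the last iterate: the smoothed objectives for different parameters are related only through their distance to \<open>F\<close>, so
  \<open>F(x\<^sub>k)\<close> may rise by as much as \<open>e\<^sub>k\<close> at each step, these rises need not be summable, and the set of
  minimizers may be unbounded, so that there is no compactness to appeal to. What excludes a rise from
  near the minimum to a fixed higher value is the choice \<open>y = x\<^sub>i\<close> for earlier iterates: as long as
  \<open>F(x\<^sub>k\<^sub>+\<^sub>1) > F(x\<^sub>i) + e\<^sub>k\<close>, the iterates move towards \<open>x\<^sub>i\<close>. Divide the rise into many levels whose
  spacing exceeds \<open>e\<^sub>k\<close>, and let \<open>p\<^sub>0, p\<^sub>1, \<dots>\<close> be the iterates at which the successive levels are left for
  the last time. Then \<open>p\<^sub>n\<close> is closer to \<open>p\<^sub>l\<close> than \<open>p\<^sub>m\<close> is, whenever \<open>l < m < n\<close>. In a Euclidean space the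
  length of such a sequence is bounded by a constant that depends only on the dimension (\<open>no_long_sequence_approaching_its_past\<close>), whereas
  the number of levels can be chosen freely. This is \<open>perturbed_descent_last_iterate\<close>.

  If \<open>\<sigma> > 0\<close>, then \<open>F\<close> grows quadratically away from its minimizer, so convergence of the values
  forces convergence of the iterates.
\<close>

section \<open>One gradient step\<close>

text \<open>The restriction of \<open>G\<close> to the line through \<open>x\<close> and \<open>y\<close> is a convex function of one real variable,
  which lies above its tangent.\<close>

lemma convex_gradient_inequality:
  fixes G :: "'a::real_inner \<Rightarrow> real"
  assumes "convex_on UNIV G" and "GDERIV G x :> g"
  shows "G x + g \<bullet> (y - x) \<le> G y"
proof -
  let ?\<phi> = "\<lambda>r::real. G (x + r *\<^sub>R (y - x))"
  have "convex_on UNIV ?\<phi>"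
  proof (rule convex_onI)
    fix r a b :: real
    assume "0 < r" "r < 1"
    moreover have "x + ((1 - r) *\<^sub>R a + r *\<^sub>R b) *\<^sub>R (y - x)
        = (1 - r) *\<^sub>R (x + a *\<^sub>R (y - x)) + r *\<^sub>R (x + b *\<^sub>R (y - x))"
      by (simp add: algebra_simps)
    ultimately show "?\<phi> ((1 - r) *\<^sub>R a + r *\<^sub>R b) \<le> (1 - r) * ?\<phi> a + r * ?\<phi> b"
      using convex_onD[OF assms(1), of r "x + a *\<^sub>R (y - x)" "x + b *\<^sub>R (y - x)"] by simp
  qed simp
  moreover have "(?\<phi> has_real_derivative g \<bullet> (y - x)) (at 0)"
  proof -
    have "(G has_derivative (\<lambda>v. v \<bullet> g)) (at (x + 0 *\<^sub>R (y - x)))"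
      using assms(2) by (simp add: gderiv_def)
    then have "(?\<phi> has_derivative (\<lambda>r. (r *\<^sub>R (y - x)) \<bullet> g)) (at 0)"
      by (rule has_derivative_compose[rotated]) (auto intro!: derivative_eq_intros)
    then show ?thesis
      by (simp add: has_field_derivative_def inner_commute mult_commute_abs)
  qed
  ultimately have "?\<phi> 1 - ?\<phi> 0 \<ge> (g \<bullet> (y - x)) * (1 - 0)"
    by (intro convex_on_imp_above_tangent[where A = UNIV]) auto
  then show ?thesis by simp
qed

lemma descent_lemma:
  fixes G :: "'a::real_inner \<Rightarrow> real"
  assumes deriv: "\<And>z. GDERIV G z :> grad z" and lip: "\<Lambda>-lipschitz_on UNIV grad"
  shows "G (x + v) \<le> G x + grad x \<bullet> v + \<Lambda> / 2 * (norm v)\<^sup>2"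
proof -
  let ?\<phi> = "\<lambda>r::real. G (x + r *\<^sub>R v) - r * (grad x \<bullet> v) - \<Lambda> / 2 * r\<^sup>2 * (norm v)\<^sup>2"
  have "?\<phi> 1 \<le> ?\<phi> 0"
  proof (rule DERIV_nonpos_imp_nonincreasing[where f = ?\<phi>])
    fix r :: real assume r: "0 \<le> r"
    let ?d = "grad (x + r *\<^sub>R v) \<bullet> v - grad x \<bullet> v - \<Lambda> * r * (norm v)\<^sup>2"
    have "(G has_derivative (\<lambda>w. w \<bullet> grad (x + r *\<^sub>R v))) (at (x + r *\<^sub>R v))"
      using deriv by (simp add: gderiv_def)
    then have "((\<lambda>r. G (x + r *\<^sub>R v)) has_derivative
        (\<lambda>q. (q *\<^sub>R v) \<bullet> grad (x + r *\<^sub>R v))) (at r)"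
      by (rule has_derivative_compose[rotated]) (auto intro!: derivative_eq_intros)
    then have "((\<lambda>r. G (x + r *\<^sub>R v)) has_real_derivative grad (x + r *\<^sub>R v) \<bullet> v) (at r)"
      by (simp add: has_field_derivative_def inner_commute mult_commute_abs)
    then have "(?\<phi> has_real_derivative ?d) (at r)"
      by (auto intro!: derivative_eq_intros)
    moreover have "?d \<le> 0"
    proof -
      have "(grad (x + r *\<^sub>R v) - grad x) \<bullet> v \<le> norm (grad (x + r *\<^sub>R v) - grad x) * norm v"
        by (rule norm_cauchy_schwarz)
      also have "norm (grad (x + r *\<^sub>R v) - grad x) \<le> \<Lambda> * (r * norm v)"
        using lipschitz_onD[OF lip, of "x + r *\<^sub>R v" x] r by (simp add: dist_norm)
      finally show ?thesis
        by (simp add: mult_right_mono inner_diff_left power2_eq_square mult.assoc)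
    qed
    ultimately show "\<exists>d. (?\<phi> has_real_derivative d) (at r) \<and> d \<le> 0"
      by blast
  qed simp
  then show ?thesis by simp
qed

text \<open>The gradient inequality at \<open>x\<close> bounds \<open>G y\<close> from below and the descent lemma bounds \<open>G x'\<close> from
  above. With step length \<open>1 / \<Lambda>\<close> the two quadratic terms in the gradient combine with its inner
  product with \<open>x - y\<close> to a difference of squared distances.\<close>

lemma gradient_step_three_point:
  fixes G :: "'a::real_inner \<Rightarrow> real"
  assumes convex: "convex_on UNIV G"
    and deriv: "\<And>z. GDERIV G z :> grad z" and lip: "\<Lambda>-lipschitz_on UNIV grad"
    and pos: "\<Lambda> > 0" and step: "x' = x - inverse \<Lambda> *\<^sub>R grad x"
  shows "(norm (x' - y))\<^sup>2 \<le> (norm (x - y))\<^sup>2 - 2 * inverse \<Lambda> * (G x' - G y)"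
proof -
  let ?g = "grad x" and ?s = "inverse \<Lambda>"
  have "G x' \<le> G x + ?g \<bullet> (- ?s *\<^sub>R ?g) + \<Lambda> / 2 * (norm (- ?s *\<^sub>R ?g))\<^sup>2"
    using descent_lemma[OF deriv lip, of x "- ?s *\<^sub>R ?g"] step by simp
  also have "\<dots> = G x - ?s / 2 * (norm ?g)\<^sup>2"
    using pos by (simp add: power_mult_distrib dot_square_norm field_simps power2_eq_square)
  finally have "G x' - G y \<le> ?g \<bullet> (x - y) - ?s / 2 * (norm ?g)\<^sup>2"
    using convex_gradient_inequality[OF convex deriv, of x y] by (simp add: inner_diff_right)
  then have "2 * ?s * (G x' - G y) \<le> 2 * ?s * (?g \<bullet> (x - y) - ?s / 2 * (norm ?g)\<^sup>2)"
    using pos by (intro mult_left_mono) auto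
  also have "\<dots> = (norm (x - y))\<^sup>2 - (norm (x' - y))\<^sup>2"
    unfolding step power2_norm_eq_inner
    by (simp add: inner_diff_left inner_diff_right inner_commute algebra_simps)
  finally show ?thesis by simp
qed

section \<open>Sequences of points that approach all their predecessors\<close>

text \<open>The unit sphere is covered by finitely many balls of radius one half. Two unit vectors in the same
  ball have distance less than one, hence an angle of less than 60 degrees; a direction is coloured by
  the centre of a ball that contains it.\<close>

lemma finite_cover_by_acute_cones:
  "\<exists>(C :: 'a::euclidean_space set) (colour :: 'a \<Rightarrow> 'a). finite C \<and> (\<forall>v. v \<noteq> 0 \<longrightarrow> colour v \<in> C) \<and>
     (\<forall>v w. v \<noteq> 0 \<longrightarrow> w \<noteq> 0 \<longrightarrow> colour v = colour w \<longrightarrow> v \<bullet> w > 0)"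
proof -
  have "seq_compact (sphere (0::'a) 1)"
    by (simp add: compact_imp_seq_compact)
  then obtain C :: "'a set" where C: "finite C" "sphere 0 1 \<subseteq> (\<Union>c\<in>C. ball c (1/2))"
    using seq_compact_imp_totally_bounded[of "sphere (0::'a) 1"] by (metis half_gt_zero zero_less_one)
  define colour where "colour v = (SOME c. c \<in> C \<and> sgn v \<in> ball c (1/2))" for v :: 'a
  have colour: "colour v \<in> C \<and> sgn v \<in> ball (colour v) (1/2)" if "v \<noteq> 0" for v
  proof -
    have "sgn v \<in> sphere 0 1"
      using that by (simp add: norm_sgn)
    then have "\<exists>c. c \<in> C \<and> sgn v \<in> ball c (1/2)"
      using C(2) by blast
    then show ?thesis
      unfolding colour_def by (rule someI_ex)
  qed
  have "v \<bullet> w > 0" if "v \<noteq> 0" "w \<noteq> 0" "colour v = colour w" for v w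
  proof -
    have "dist (sgn v) (sgn w) < 1"
      using colour[OF that(1)] colour[OF that(2)] that(3)
        dist_triangle_half_l[of "sgn v" "colour v" 1 "sgn w"] by (simp add: dist_commute)
    then have "(norm (sgn v - sgn w))\<^sup>2 < 1"
      by (simp add: dist_norm power_less_one_iff abs_square_less_1)
    moreover have "(norm (sgn v - sgn w))\<^sup>2
        = (norm (sgn v))\<^sup>2 + (norm (sgn w))\<^sup>2 - 2 * (sgn v \<bullet> sgn w)"
      unfolding power2_norm_eq_inner by (simp add: inner_diff_left inner_diff_right inner_commute)
    ultimately have "sgn v \<bullet> sgn w > 0"
      using that by (simp add: norm_sgn)
    then show ?thesis
      using that by (simp add: sgn_div_norm zero_less_mult_iff)
  qed
  then show ?thesis
    using C(1) colour by blast
qed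

text \<open>If \<open>p n\<close> is closer to \<open>p l\<close> than \<open>p m\<close> is, then the displacements \<open>p m - p l\<close> and \<open>p n - p m\<close> form an
  obtuse angle, so they have different colours. The set of colours of the displacements that lead out
  of \<open>p l\<close> thus contains the colour of \<open>p m - p l\<close>, while the corresponding set for \<open>p m\<close> does not. These
  sets of colours are therefore pairwise distinct, which bounds the length of the sequence by the
  number of sets of colours.\<close>

lemma no_long_sequence_approaching_its_past:
  "\<exists>N :: nat. \<forall>p :: nat \<Rightarrow> 'a::euclidean_space.
     \<exists>l m n. l < m \<and> m < n \<and> n \<le> N \<and> norm (p m - p l) \<le> norm (p n - p l)"
proof -
  obtain C :: "'a set" and colour :: "'a \<Rightarrow> 'a" where C: "finite C"
    and col: "\<And>v. v \<noteq> 0 \<Longrightarrow> colour v \<in> C"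
    and acute: "\<And>v w. v \<noteq> 0 \<Longrightarrow> w \<noteq> 0 \<Longrightarrow> colour v = colour w \<Longrightarrow> v \<bullet> w > 0"
    using finite_cover_by_acute_cones by metis
  define N where "N = Suc (card (Pow C))"
  have "\<exists>l m n. l < m \<and> m < n \<and> n \<le> N \<and> norm (p m - p l) \<le> norm (p n - p l)"
    for p :: "nat \<Rightarrow> 'a"
  proof (rule ccontr)
    assume contr: "\<not> ?thesis"
    then have closer: "norm (p n - p l) < norm (p m - p l)" if "l < m" "m < n" "n \<le> N" for l m n
      using that by (meson not_le)
    have distinct: "p m - p l \<noteq> 0" if "l < m" "m < N" for l m
      using closer[of l m N] that by auto
    \<comment> \<open>Excluding the last index \<open>N\<close> keeps all displacements nonzero: \<open>p N\<close> is strictly closer to \<open>p l\<close>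
      than \<open>p m\<close> is.\<close>
    define Out where "Out l = {colour (p m - p l) | m. l < m \<and> m < N}" for l
    have "Out l \<noteq> Out m" if lm: "l < m" "m < N" for l m
    proof
      assume "Out l = Out m"
      moreover have "colour (p m - p l) \<in> Out l"
        using lm by (auto simp: Out_def)
      ultimately obtain n where n: "m < n" "n < N" "colour (p m - p l) = colour (p n - p m)"
        by (auto simp: Out_def)
      have "(p m - p l) \<bullet> (p n - p m) > 0"
        using n lm distinct by (intro acute) auto
      moreover have "(norm (p n - p l))\<^sup>2
          = (norm (p m - p l))\<^sup>2 + 2 * ((p m - p l) \<bullet> (p n - p m)) + (norm (p n - p m))\<^sup>2"
        unfolding power2_norm_eq_inner
        by (simp add: inner_diff_left inner_diff_right inner_commute algebra_simps)
      ultimately have "(norm (p n - p l))\<^sup>2 > (norm (p m - p l))\<^sup>2"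
        by (smt (verit) zero_le_power2)
      then have "norm (p m - p l) < norm (p n - p l)"
        by (rule power2_less_imp_less) simp
      then show False
        using closer[of l m n] lm n by simp
    qed
    then have "inj_on Out {..<N}"
      by (intro linorder_inj_onI) auto
    moreover have "Out ` {..<N} \<subseteq> Pow C"
      using col distinct by (auto simp: Out_def)
    ultimately have "card {..<N} \<le> card (Pow C)"
      using C by (intro card_inj_on_le) auto
    then show False
      by (simp add: N_def)
  qed
  then show ?thesis by blast
qed

section \<open>Perturbed descent\<close>

text \<open>While \<open>F\<close> exceeds \<open>F y\<close> by more than \<open>\<eta>\<close> and the errors are below \<open>\<eta> / 2\<close>, the squared distance to
  \<open>y\<close> falls at least at rate \<open>\<eta>\<close> with respect to \<open>t\<close>. It is nonnegative and \<open>t\<close> is unbounded, so this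
  cannot last.\<close>

lemma perturbed_descent_frequently_small:
  fixes F :: "'a::real_normed_vector \<Rightarrow> real"
  assumes step: "\<And>k. (norm (x (Suc k) - y))\<^sup>2
        \<le> (norm (x k - y))\<^sup>2 - 2 * (t (Suc k) - t k) * (F (x (Suc k)) - F y - e k)"
    and t_mono: "\<And>k. t k \<le> t (Suc k)" and t_top: "filterlim t at_top sequentially"
    and e: "e \<longlonglongrightarrow> 0" and \<eta>: "\<eta> > 0"
  shows "\<exists>k\<ge>K. F (x k) \<le> F y + \<eta>"
proof (rule ccontr)
  assume "\<not> ?thesis"
  then have large: "F (x k) > F y + \<eta>" if "k \<ge> K" for k
    using that by force
  have "\<forall>\<^sub>F k in sequentially. e k < \<eta> / 2"
    using e \<eta> by (intro order_tendstoD) auto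
  then obtain K' where K': "\<And>k. k \<ge> K' \<Longrightarrow> e k < \<eta> / 2"
    by (auto simp: eventually_sequentially)
  define M where "M = max K K'"
  define V where "V k = (norm (x k - y))\<^sup>2 + \<eta> * t k" for k
  have V_Suc: "V (Suc k) \<le> V k" if "k \<ge> M" for k
  proof -
    have "(t (Suc k) - t k) * (\<eta> / 2) \<le> (t (Suc k) - t k) * (F (x (Suc k)) - F y - e k)"
      using large[of "Suc k"] K'[of k] that t_mono[of k] unfolding M_def
      by (intro mult_left_mono) auto
    then show ?thesis
      using step[of k] by (simp add: V_def algebra_simps)
  qed
  have V: "V k \<le> V M" if "k \<ge> M" for k
    using that
  proof (induction k rule: dec_induct)
    case (step k)
    then show ?case
      using V_Suc[of k] by simp
  qed simp
  have "\<forall>\<^sub>F k in sequentially. V M / \<eta> < t k"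
    using t_top by (simp add: filterlim_at_top_dense)
  then obtain k where k: "k \<ge> M" "V M / \<eta> < t k"
    by (metis eventually_sequentially le_cases)
  then have "V M < \<eta> * t k"
    using \<eta> by (simp add: field_simps)
  then show False
    using V[OF k(1)] by (simp add: V_def) (smt (verit) zero_le_power2)
qed

text \<open>Once \<open>F\<close> has been within \<open>\<eta>\<close> of its minimum and the errors have fallen below \<open>\<eta>\<close>, a later rise to
  \<open>b\<close> would cross \<open>N + 1\<close> levels with spacing \<open>\<eta>\<close>. Consider the last times at which \<open>F\<close> is below each
  level. They are distinct, because a single step raises \<open>F\<close> by at most the error; and after the last
  time at some level the iterates approach the last iterates at all lower levels. The number \<open>N\<close> is
  the one that makes such a sequence impossible, and \<open>\<eta>\<close> is chosen to fit \<open>N\<close>.\<close>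

lemma perturbed_descent_last_iterate:
  fixes F :: "'a::euclidean_space \<Rightarrow> real"
  assumes step: "\<And>k y. (norm (x (Suc k) - y))\<^sup>2
        \<le> (norm (x k - y))\<^sup>2 - 2 * (t (Suc k) - t k) * (F (x (Suc k)) - F y - e k)"
    and t_less: "\<And>k. t k < t (Suc k)" and t_top: "filterlim t at_top sequentially"
    and e: "e \<longlonglongrightarrow> 0" and min: "\<And>y. F xmin \<le> F y"
  shows "(\<lambda>k. F (x k)) \<longlonglongrightarrow> F xmin"
proof (rule order_tendstoI)
  show "\<forall>\<^sub>F k in sequentially. a < F (x k)" if "a < F xmin" for a
    using that min by (auto intro: less_le_trans always_eventually)
next
  fix b assume b: "F xmin < b"
  obtain N where N: "\<And>p :: nat \<Rightarrow> 'a.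
      \<exists>l m n. l < m \<and> m < n \<and> n \<le> N \<and> norm (p m - p l) \<le> norm (p n - p l)"
    using no_long_sequence_approaching_its_past by blast
  define \<eta> where "\<eta> = (b - F xmin) / (real N + 2)"
  have \<eta>: "\<eta> > 0" and b_eq: "b = F xmin + (real N + 2) * \<eta>"
    using b by (simp_all add: \<eta>_def)
  have "\<forall>\<^sub>F k in sequentially. e k < \<eta>"
    using e \<eta> by (intro order_tendstoD) auto
  then obtain K where K: "\<And>k. k \<ge> K \<Longrightarrow> e k < \<eta>"
    by (auto simp: eventually_sequentially)
  obtain k0 where k0: "k0 \<ge> K" "F (x k0) \<le> F xmin + \<eta>"
    using perturbed_descent_frequently_small[OF step less_imp_le[OF t_less] t_top e \<eta>] by blast
  have "F (x k1) < b" if "k1 \<ge> k0" for k1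
  proof (rule ccontr)
    assume "\<not> F (x k1) < b"
    define level where "level m = F xmin + (real m + 1) * \<eta>" for m
    define below where "below m = {k. k0 \<le> k \<and> k \<le> k1 \<and> F (x k) \<le> level m}" for m
    define exit where "exit m = Max (below m)" for m
    have level_Suc: "level (Suc m) = level m + \<eta>" for m
      by (simp add: level_def algebra_simps)
    have level_mono: "level l \<le> level m" if "l \<le> m" for l m
      using that \<eta> by (simp add: level_def)
    have fin: "finite (below m)" for m
      by (rule finite_subset[of _ "{..k1}"]) (auto simp: below_def)
    have "F xmin + \<eta> \<le> level m" for m
      using level_mono[of 0 m] by (simp add: level_def)
    then have "k0 \<in> below m" for m
      using k0 that by (auto simp: below_def intro: order_trans)
    then have exit_in: "exit m \<in> below m" for m
      unfolding exit_def using fin by (intro Max_in) auto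
    have above: "level m < F (x k)" if "exit m < k" "k \<le> k1" for m k
    proof (rule ccontr)
      assume "\<not> ?thesis"
      then have "k \<in> below m"
        using that exit_in[of m] by (auto simp: below_def)
      then have "k \<le> exit m"
        unfolding exit_def using fin by (intro Max_ge)
      then show False
        using that by simp
    qed
    have exit_less: "exit m < k1" if "m \<le> N" for m
    proof -
      have "level m < b"
        using that \<eta> by (simp add: level_def b_eq)
      then have "exit m \<noteq> k1"
        using exit_in[of m] \<open>\<not> F (x k1) < b\<close> by (auto simp: below_def)
      then show ?thesis
        using exit_in[of m] by (simp add: below_def)
    qed
    have exit_Suc: "exit m < exit (Suc m)" if "m \<le> N" for m
    proof -
      let ?k = "exit m"
      \<comment> \<open>The step inequality with \<open>y\<close> the current iterate bounds the rise in one step by \<open>e\<close>.\<close>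
      have "0 \<le> (norm (x (Suc ?k) - x ?k))\<^sup>2"
        by simp
      also have "\<dots> \<le> - (2 * (t (Suc ?k) - t ?k) * (F (x (Suc ?k)) - F (x ?k) - e ?k))"
        using step[of ?k "x ?k"] by simp
      finally have "(2 * (t (Suc ?k) - t ?k)) * (F (x (Suc ?k)) - F (x ?k) - e ?k) \<le> 0"
        by linarith
      then have "F (x (Suc ?k)) - F (x ?k) - e ?k \<le> 0"
        using t_less[of ?k] by (meson diff_gt_0_iff_gt mult_pos_pos not_le zero_less_numeral)
      moreover have "e ?k < \<eta>" "F (x ?k) \<le> level m"
        using exit_in[of m] k0 K by (auto simp: below_def)
      ultimately have "Suc ?k \<in> below (Suc m)"
        using exit_in[of m] exit_less[OF that] by (auto simp: below_def level_Suc)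
      then have "Suc ?k \<le> exit (Suc m)"
        unfolding exit_def[of "Suc m"] using fin by (intro Max_ge)
      then show ?thesis by simp
    qed
    have exit_mono: "exit l < exit m" if "l < m" "m \<le> N" for l m
      using that
    proof (induction m)
      case (Suc m)
      then show ?case
        using exit_Suc[of m] by (cases "l = m") auto
    qed simp
    have approach: "norm (x k - x (exit l)) < norm (x (exit m) - x (exit l))"
      if "l < m" "exit m < k" "k \<le> k1" for l m k
    proof -
      have closer: "norm (x (Suc j) - x (exit l)) < norm (x j - x (exit l))"
        if j: "exit m \<le> j" "j < k1" for j
      proof -
        have "F (x (exit l)) \<le> level l" "level l + \<eta> \<le> level m" "level m < F (x (Suc j))"
          using exit_in[of l] above[of m "Suc j"] j level_mono[of "Suc l" m] \<open>l < m\<close>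
          by (auto simp: below_def level_Suc)
        moreover have "e j < \<eta>"
          using K[of j] k0 j exit_in[of m] by (auto simp: below_def)
        ultimately have "0 < 2 * (t (Suc j) - t j) * (F (x (Suc j)) - F (x (exit l)) - e j)"
          using t_less[of j] by simp
        then have "(norm (x (Suc j) - x (exit l)))\<^sup>2 < (norm (x j - x (exit l)))\<^sup>2"
          using step[of j "x (exit l)"] by linarith
        then show ?thesis
          by (rule power2_less_imp_less) simp
      qed
      have "Suc (exit m) \<le> k"
        using that by simp
      then show ?thesis
        using \<open>k \<le> k1\<close>
      proof (induction k rule: dec_induct)
        case base
        then show ?case by (intro closer) auto
      next
        case (step j)
        then show ?case
          using closer[of j] by simp
      qed
    qed
    obtain l m n where lmn: "l < m" "m < n" "n \<le> N"
      and "norm (x (exit m) - x (exit l)) \<le> norm (x (exit n) - x (exit l))"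
      using N[of "\<lambda>m. x (exit m)"] by blast
    then show False
      using approach[of l m "exit n"] exit_mono[of m n] exit_less[of n] by simp
  qed
  then show "\<forall>\<^sub>F k in sequentially. F (x k) < b"
    by (auto simp: eventually_sequentially)
qed

section \<open>Strong convexity, divergence of the times, and convergence\<close>

lemma strongly_convex_imp_convex:
  fixes f :: "'a::real_inner \<Rightarrow> real"
  assumes "strongly_convex \<sigma> f"
  shows "convex_on UNIV f"
proof -
  have "convex_on UNIV (\<lambda>x::'a. (norm x)\<^sup>2)"
  proof (rule convex_onI)
    fix r :: real and x y :: 'a
    assume r: "0 < r" "r < 1"
    have "(1 - r) * (norm x)\<^sup>2 + r * (norm y)\<^sup>2 - (norm ((1 - r) *\<^sub>R x + r *\<^sub>R y))\<^sup>2
        = r * (1 - r) * (norm (x - y))\<^sup>2"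
      unfolding power2_norm_eq_inner
      by (simp add: inner_add_left inner_add_right inner_diff_left inner_diff_right
          inner_commute algebra_simps)
    moreover have "0 \<le> r * (1 - r) * (norm (x - y))\<^sup>2"
      using r by simp
    ultimately show "(norm ((1 - r) *\<^sub>R x + r *\<^sub>R y))\<^sup>2 \<le> (1 - r) * (norm x)\<^sup>2 + r * (norm y)\<^sup>2"
      by linarith
  qed simp
  then have "convex_on UNIV (\<lambda>x. (f x - \<sigma> / 2 * (norm x)\<^sup>2) + \<sigma> / 2 * (norm x)\<^sup>2)"
    using assms by (intro convex_on_add convex_on_cmul) (auto simp: strongly_convex_def)
  then show ?thesis by simp
qed

lemma strongly_convex_add_convex:
  assumes "strongly_convex \<sigma> f" and "convex_on UNIV h"
  shows "strongly_convex \<sigma> (\<lambda>x. f x + h x)"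
proof -
  have "convex_on UNIV (\<lambda>x. (f x - \<sigma> / 2 * (norm x)\<^sup>2) + h x)"
    using assms by (intro convex_on_add) (auto simp: strongly_convex_def)
  then show ?thesis
    using assms by (simp add: strongly_convex_def algebra_simps)
qed

text \<open>Strong convexity is applied at the midpoint of \<open>xmin\<close> and \<open>y\<close>, where \<open>F\<close> is at least \<open>F xmin\<close>.
  Points closer to \<open>xmin\<close> would give the sharp constant \<open>\<sigma> / 2\<close> in the limit.\<close>

lemma strongly_convex_quadratic_growth:
  fixes F :: "'a::real_inner \<Rightarrow> real"
  assumes "strongly_convex \<sigma> F" and min: "\<And>y. F xmin \<le> F y"
  shows "\<sigma> / 4 * (norm (y - xmin))\<^sup>2 \<le> F y - F xmin"
proof -
  define m where "m = (1 - 1/2) *\<^sub>R xmin + (1/2) *\<^sub>R y"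
  have "F m - \<sigma> / 2 * (norm m)\<^sup>2
      \<le> (1 - 1/2) * (F xmin - \<sigma> / 2 * (norm xmin)\<^sup>2) + 1/2 * (F y - \<sigma> / 2 * (norm y)\<^sup>2)"
    using assms(1) unfolding strongly_convex_def m_def
    by (intro convex_onD[of UNIV "\<lambda>x. F x - \<sigma> / 2 * (norm x)\<^sup>2"]) auto
  moreover have "(norm m)\<^sup>2 = (norm xmin)\<^sup>2 / 2 + (norm y)\<^sup>2 / 2 - (norm (y - xmin))\<^sup>2 / 4"
    unfolding power2_norm_eq_inner m_def
    by (simp add: inner_add_left inner_add_right inner_diff_left inner_diff_right
        inner_commute field_simps)
  ultimately have "F m + \<sigma> / 8 * (norm (y - xmin))\<^sup>2 \<le> F xmin / 2 + F y / 2"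
    by (simp only:) (simp add: algebra_simps)
  then show ?thesis
    using min[of m] by linarith
qed

text \<open>If the times were bounded by \<open>T\<close>, then \<open>\<mu> (t k) \<ge> \<mu> T > 0\<close> by monotonicity, so every increment
  would be at least the positive constant \<open>inverse (L + \<alpha> / \<mu> T)\<close>.\<close>

lemma smoothing_times_diverge:
  fixes \<mu> :: "real \<Rightarrow> real" and t :: "nat \<Rightarrow> real"
  assumes pos: "\<And>r. r \<ge> t 0 \<Longrightarrow> \<mu> r > 0" and anti: "antimono_on {t 0..} \<mu>"
    and "L \<ge> 0" and "\<alpha> > 0"
    and step: "\<And>k. t (Suc k) = t k + inverse (L + \<alpha> / \<mu> (t k))"
  shows "t k \<ge> t 0" and "t k < t (Suc k)" and "filterlim t at_top sequentially"
proof -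
  have ge: "t 0 \<le> t k" for k
  proof (induction k)
    case (Suc k)
    then have "0 < inverse (L + \<alpha> / \<mu> (t k))"
      using pos[of "t k"] assms(3,4) by (simp add: add_nonneg_pos)
    then show ?case
      using Suc step[of k] by linarith
  qed simp
  have less: "t k < t (Suc k)" for k
    using pos[OF ge, of k] assms(3,4) step[of k] by (simp add: add_nonneg_pos)
  show "t k \<ge> t 0" "t k < t (Suc k)"
    by (rule ge, rule less)
  have incseq: "incseq t"
    using less by (intro incseq_SucI less_imp_le)
  have "\<exists>k. T \<le> t k" for T
  proof (rule ccontr)
    assume "\<not> ?thesis"
    then have bound: "t k < T" for k
      by (simp add: not_le)
    have T: "t 0 \<le> T"
      using bound[of 0] by simp
    define c where "c = inverse (L + \<alpha> / \<mu> T)"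
    have c: "c > 0"
      using pos[OF T] assms(3,4) by (simp add: c_def add_nonneg_pos)
    have increment: "t k + c \<le> t (Suc k)" for k
    proof -
      have "\<mu> T \<le> \<mu> (t k)"
        using monotone_onD[OF anti, of "t k" T] ge[of k] T bound[of k] by simp
      then have "\<alpha> / \<mu> (t k) \<le> \<alpha> / \<mu> T"
        using pos[OF T] assms(4) by (intro divide_left_mono) auto
      then have "c \<le> inverse (L + \<alpha> / \<mu> (t k))"
        unfolding c_def using pos[OF ge, of k] assms(3,4)
        by (intro le_imp_inverse_le) (auto simp: add_nonneg_pos)
      then show ?thesis
        using step[of k] by simp
    qed
    have grow: "t 0 + real k * c \<le> t k" for k
    proof (induction k)
      case (Suc k)
      then have "t 0 + real k * c + c \<le> t (Suc k)"
        using increment[of k] by linarith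
      then show ?case
        by (simp add: algebra_simps)
    qed simp
    obtain k where "T - t 0 < real k * c"
      using reals_Archimedean3[OF c] by blast
    then show False
      using grow[of k] bound[of k] by simp
  qed
  then show "filterlim t at_top sequentially"
    unfolding filterlim_at_top eventually_sequentially
    using incseq by (meson incseqD order_trans)
qed

theorem corollary4:
  fixes f h :: "real ^ 'n \<Rightarrow> real"
    and ht :: "real ^ 'n \<Rightarrow> real \<Rightarrow> real"
    and \<mu> :: "real \<Rightarrow> real"
    and t s :: "nat \<Rightarrow> real"
    and x :: "nat \<Rightarrow> real ^ 'n"
    and x0 xstar :: "real ^ 'n"
    and L \<sigma> \<alpha> \<beta> t0 :: real
  assumes "\<sigma> \<ge> 0" and "L \<ge> 0"
    and "strongly_convex \<sigma> f"
    and "smooth_fun L f"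
    and "convex_on UNIV h"
    and "smooth_approximation \<alpha> \<beta> h ht"
    and "\<forall>y. f xstar + h xstar \<le> f y + h y"
    and "\<forall>r\<ge>t0. \<mu> r > 0"
    and "antimono_on {t0..} \<mu>"
    and "(\<mu> \<longlongrightarrow> 0) at_top"
    and "t 0 = t0" and "x 0 = x0"
    and "\<forall>k. s k = inverse (L + \<alpha> / \<mu> (t k))"
    and "\<forall>k. t (Suc k) = t k + inverse (L + \<alpha> / \<mu> (t k))"
    and "\<forall>k. x (Suc k) = x k - s k *\<^sub>R gradient (\<lambda>y. f y + ht y (\<mu> (t k))) (x k)"
  shows "(\<lambda>k. f (x k) + h (x k)) \<longlonglongrightarrow> f xstar + h xstar \<and>
         (\<sigma> > 0 \<longrightarrow> x \<longlonglongrightarrow> xstar)"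
proof -
  define F where "F y = f y + h y" for y
  define Ft where "Ft k y = f y + ht y (\<mu> (t k))" for k y
  have approx: "convex_on UNIV (\<lambda>y. ht y m)" "ht y m \<le> h y"
      "h y \<le> ht y m + \<beta> * m" "smooth_fun (\<alpha> / m) (\<lambda>y. ht y m)" if "m > 0" for m y
    using assms(6) that by (auto simp: smooth_approximation_def)
  have \<alpha>: "\<alpha> > 0"
    using assms(6) by (simp add: smooth_approximation_def)
  have mu_pos: "\<And>r. r \<ge> t 0 \<Longrightarrow> \<mu> r > 0" and anti: "antimono_on {t 0..} \<mu>"
    using assms(8,9,11) by auto
  have t_step: "\<And>k. t (Suc k) = t k + inverse (L + \<alpha> / \<mu> (t k))"
    using assms(14) by simp
  note times = smoothing_times_diverge[OF mu_pos anti assms(2) \<alpha> t_step]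
  have mu_k: "\<mu> (t k) > 0" for k
    using times(1) by (rule mu_pos)
  have "(\<lambda>k. \<mu> (t k)) \<longlonglongrightarrow> 0"
    using assms(10) times(3) by (rule filterlim_compose)
  then have err: "(\<lambda>k. \<beta> * \<mu> (t k)) \<longlonglongrightarrow> 0"
    by (rule tendsto_mult_right_zero)
  have three_point: "(norm (x (Suc k) - y))\<^sup>2 \<le> (norm (x k - y))\<^sup>2
      - 2 * (t (Suc k) - t k) * (F (x (Suc k)) - F y - \<beta> * \<mu> (t k))" for k y
  proof -
    let ?m = "\<mu> (t k)" and ?\<Lambda> = "L + \<alpha> / \<mu> (t k)"
    let ?grad = "\<lambda>z. gradient f z + gradient (\<lambda>y. ht y ?m) z"
    have \<Lambda>: "?\<Lambda> > 0"
      using mu_k[of k] \<alpha> assms(2) by (simp add: add_nonneg_pos)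
    have deriv: "GDERIV (Ft k) z :> ?grad z" for z
      unfolding Ft_def using assms(4) approx(4)[OF mu_k]
      by (intro GDERIV_add GDERIV_gradient) (auto simp: smooth_fun_def)
    have lip: "?\<Lambda>-lipschitz_on UNIV ?grad"
      using assms(4) approx(4)[OF mu_k[of k]]
      by (intro lipschitz_on_add) (auto simp: smooth_fun_def)
    have convex: "convex_on UNIV (Ft k)"
      unfolding Ft_def
      using strongly_convex_imp_convex[OF assms(3)] approx(1)[OF mu_k] by (rule convex_on_add)
    have "x (Suc k) = x k - inverse ?\<Lambda> *\<^sub>R ?grad (x k)"
      using assms(13,15) gradient_eqI[OF deriv[of "x k"]] by (simp add: Ft_def[abs_def])
    then have "(norm (x (Suc k) - y))\<^sup>2
        \<le> (norm (x k - y))\<^sup>2 - 2 * inverse ?\<Lambda> * (Ft k (x (Suc k)) - Ft k y)"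
      by (rule gradient_step_three_point[OF convex deriv lip \<Lambda>])
    \<comment> \<open>The approximation underestimates \<open>h\<close>, and by at most \<open>\<beta> * ?m\<close>: the first is used at \<open>y\<close>,
      the second at the new iterate.\<close>
    moreover have "2 * inverse ?\<Lambda> * (F (x (Suc k)) - F y - \<beta> * ?m)
        \<le> 2 * inverse ?\<Lambda> * (Ft k (x (Suc k)) - Ft k y)"
      using approx(2)[OF mu_k, of y k] approx(3)[OF mu_k, of "x (Suc k)" k] \<Lambda>
      by (intro mult_left_mono) (auto simp: F_def Ft_def)
    ultimately show ?thesis
      using t_step[of k] by simp
  qed
  have min: "F xstar \<le> F y" for y
    using assms(7) by (simp add: F_def)
  have F_lim: "(\<lambda>k. F (x k)) \<longlonglongrightarrow> F xstar"
    using three_point times(2,3) err min by (rule perturbed_descent_last_iterate)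
  moreover have "x \<longlonglongrightarrow> xstar" if "\<sigma> > 0"
  proof -
    have "strongly_convex \<sigma> F"
      unfolding F_def using assms(3,5) by (rule strongly_convex_add_convex)
    then have growth: "\<sigma> / 4 * (norm (y - xstar))\<^sup>2 \<le> F y - F xstar" for y
      using min by (rule strongly_convex_quadratic_growth)
    have upper: "(norm (x k - xstar))\<^sup>2 \<le> 4 / \<sigma> * (F (x k) - F xstar)" for k
      using growth[of "x k"] that by (simp add: field_simps)
    have "(\<lambda>k. 4 / \<sigma> * (F (x k) - F xstar)) \<longlonglongrightarrow> 0"
      using F_lim by (intro tendsto_mult_right_zero) (simp add: LIM_zero)
    then have "(\<lambda>k. (norm (x k - xstar))\<^sup>2) \<longlonglongrightarrow> 0"
      by (rule real_tendsto_sandwich[OF _ _ tendsto_const, rotated 2])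
        (intro always_eventually allI upper zero_le_power2)+
    then have "(\<lambda>k. norm (x k - xstar)) \<longlonglongrightarrow> 0"
      using tendsto_real_sqrt by fastforce
    then show ?thesis
      by (metis LIM_zero_cancel tendsto_norm_zero_cancel)
  qed
  ultimately show ?thesis
    by (simp add: F_def)
qed

end
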